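(* Let $m\geq 3$ be a fixed integer, and let $d(n)=d_{\mathsf{H}_m}(n)$ be the depth function of the Hanoi automaton $\mathsf{H}_m$. Then $d(n)=O(\log^{m-2} n)$ as $n\to\infty$.
   Context: Automata. An automaton $\mathsf{A}$ over a finite alphabet $X$ is a finite directed labeled graph whose vertices are called states, such that for each state $s$ and each letter $x\in X$ there is a unique outgoing arrow at $s$ labeled $x|y$ for some $y\in X$. Let $X^{*}$ be the set of finite words over $X$ (including the empty word). For a state $s$ and a word $v=x_1x_2\ldots x_k\in X^{*}$ there is a unique directed path starting at $s$ labeled $x_1|y_1,\ldots,x_k|y_k$; the word $s(v):=y_1\ldots y_k$ is the image of $v$ under $s$, and the end vertex $s|_v$ of this path is the section of $s$ at $v$. Words over states. A word $s_1s_2\ldots s_n$ over the states acts on $X^{*}$ by composition, as a left action: $(s_1s_2\ldots s_n)(v)=(s_1\ldots s_{n-1})(s_n(v))$. The section of the word $s_1s_2\ldots s_n$ at $v\in X^{*}$ is the word over states $$(s_1s_2\ldots s_n)|_v=s_1's_2'\ldots s_n',\qquad s_i'=s_i|_{(s_{i+1}\ldots s_n)(v)}.$$ Sections are treated as words over states; two sections are equal if and only if they are equal as words of states. Depth function. $d_{\mathsf{A}}(s_1s_2\ldots s_n)$ is the least integer $d$ such that for every $v\in X^{*}$ there exists a word $u\in X^{*}$ of length $\leq d$ with $(s_1s_2\ldots s_n)|_v=(s_1s_2\ldots s_n)|_u$. The depth function of $\mathsf{A}$ is $$d_{\mathsf{A}}(n)=\max\{d_{\mathsf{A}}(s_1s_2\ldots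 s_k) : s_i\in\mathsf{A},\ k\leq n\},\quad n=1,2,\ldots.$$ Hanoi automaton. $\mathsf{H}_m$ is the automaton over the alphabet $X_m=\{1,2,\ldots,m\}$ whose states are a trivial state $e$ and one state $a_{(ij)}$ for every transposition $(i,j)$ on $X_m$. All arrows outgoing from $e$ end in $e$ and are labeled $x|x$, $x\in X_m$. Each state $a_{(ij)}$ has two arrows to $e$, labeled $i|j$ and $j|i$, and its other outgoing arrows are loops at $a_{(ij)}$ labeled $x|x$ for every $x\in X_m\setminus\{i,j\}$. Here $\log^{m-2} n$ means $(\log n)^{m-2}$, and the constant implied by $O(\cdot)$ may depend on $m$. *)

theory Defs
  imports Complex_Main "HOL-Library.Landau_Symbols" "HOL-Combinatorics.Transposition"
begin

section \<open>Automata\<close>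

text \<open>
  The unique arrow leaving state \<open>s\<close> with input letter \<open>x\<close> is labelled \<open>x | out A s x\<close> and
  ends in \<open>step A s x\<close>.
\<close>

record ('s, 'x) automaton =
  states :: "'s set"
  alphabet :: "'x set"
  step :: "'s \<Rightarrow> 'x \<Rightarrow> 's"
  out :: "'s \<Rightarrow> 'x \<Rightarrow> 'x"

locale finite_automaton =
  fixes A :: "('s, 'x) automaton"
  assumes finite_states: "finite (states A)"
    and finite_alphabet: "finite (alphabet A)"
    and step_closed: "\<lbrakk>s \<in> states A; x \<in> alphabet A\<rbrakk> \<Longrightarrow> step A s x \<in> states A"
    and out_closed: "\<lbrakk>s \<in> states A; x \<in> alphabet A\<rbrakk> \<Longrightarrow> out A s x \<in> alphabet A"

text \<open>The image \<open>s(v)\<close> and the section of \<open>s\<close> at \<open>v\<close>, for a single state \<open>s\<close>.\<close>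

fun state_image :: "('s, 'x) automaton \<Rightarrow> 's \<Rightarrow> 'x list \<Rightarrow> 'x list" where
  "state_image A s [] = []"
| "state_image A s (x # v) = out A s x # state_image A (step A s x) v"

fun state_section :: "('s, 'x) automaton \<Rightarrow> 's \<Rightarrow> 'x list \<Rightarrow> 's" where
  "state_section A s [] = s"
| "state_section A s (x # v) = state_section A (step A s x) v"

text \<open>Words over states act from the left: the last state of the list acts first.\<close>

fun word_image :: "('s, 'x) automaton \<Rightarrow> 's list \<Rightarrow> 'x list \<Rightarrow> 'x list" where
  "word_image A [] v = v"
| "word_image A (s # w) v = state_image A s (word_image A w v)"

fun word_section :: "('s, 'x) automaton \<Rightarrow> 's list \<Rightarrow> 'x list \<Rightarrow> 's list" where
  "word_section A [] v = []"
| "word_section A (s # w) v = state_section A s (word_image A w v) # word_section A w v"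

definition word_depth :: "('s, 'x) automaton \<Rightarrow> 's list \<Rightarrow> nat" where
  "word_depth A w = (LEAST d. \<forall>v \<in> lists (alphabet A). \<exists>u \<in> lists (alphabet A).
     length u \<le> d \<and> word_section A w v = word_section A w u)"

text \<open>
  The empty word, which has depth 0, is admitted; this does not affect the maximum for \<open>n \<ge> 1\<close>.
\<close>

definition depth_function :: "('s, 'x) automaton \<Rightarrow> nat \<Rightarrow> nat" where
  "depth_function A n = Max (word_depth A ` {w \<in> lists (states A). length w \<le> n})"

text \<open>For finite automata both the least \<open>d\<close> and the maximum exist.\<close>

context finite_automaton
begin

lemma state_image_closed:
  "\<lbrakk>s \<in> states A; v \<in> lists (alphabet A)\<rbrakk> \<Longrightarrow> state_image A s v \<in> lists (alphabet A)"
  by (induction v arbitrary: s) (auto simp: step_closed out_closed)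

lemma state_section_closed:
  "\<lbrakk>s \<in> states A; v \<in> lists (alphabet A)\<rbrakk> \<Longrightarrow> state_section A s v \<in> states A"
  by (induction v arbitrary: s) (auto simp: step_closed)

lemma word_image_closed:
  "\<lbrakk>w \<in> lists (states A); v \<in> lists (alphabet A)\<rbrakk> \<Longrightarrow> word_image A w v \<in> lists (alphabet A)"
  by (induction w) (auto simp: state_image_closed simp del: in_lists_conv_set)

lemma word_section_closed:
  "\<lbrakk>w \<in> lists (states A); v \<in> lists (alphabet A)\<rbrakk> \<Longrightarrow> word_section A w v \<in> lists (states A)"
  by (induction w)
    (auto simp: state_section_closed word_image_closed simp del: in_lists_conv_set)

lemma length_word_section: "length (word_section A w v) = length w"
  by (induction w) auto

lemma word_depth_exists:
  assumes "w \<in> lists (states A)"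
  shows "\<exists>d. \<forall>v \<in> lists (alphabet A). \<exists>u \<in> lists (alphabet A).
     length u \<le> d \<and> word_section A w v = word_section A w u"
proof -
  let ?S = "word_section A w ` lists (alphabet A)"
  have "?S \<subseteq> {w'. set w' \<subseteq> states A \<and> length w' = length w}"
    using word_section_closed[OF assms] length_word_section by auto
  then have "finite ?S"
    using finite_lists_length_eq[OF finite_states] by (rule finite_subset)
  then obtain U where U: "U \<subseteq> lists (alphabet A)" "finite U" "?S = word_section A w ` U"
    using finite_subset_image[of ?S "word_section A w" "lists (alphabet A)"] by auto
  have "\<exists>u \<in> lists (alphabet A). length u \<le> Max (length ` U) \<and> word_section A w v = word_section A w u"
    if "v \<in> lists (alphabet A)" for v
  proof -
    have "word_section A w v \<in> word_section A w ` U"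
      using that U(3) by blast
    then obtain u where "u \<in> U" "word_section A w v = word_section A w u"
      by blast
    then show ?thesis
      using U by (intro bexI[of _ u]) auto
  qed
  then show ?thesis by blast
qed

lemma finite_words: "finite {w \<in> lists (states A). length w \<le> n}"
  using finite_lists_length_le[OF finite_states, of n] by (simp add: lists_eq_set)

end


section \<open>The Hanoi automaton\<close>

text \<open>
  The state \<open>a\<^sub>\<tau>\<close> is indexed by the transposition \<open>\<tau>\<close> itself, taken as a permutation of the
  natural numbers, so that \<open>(i, j)\<close> and \<open>(j, i)\<close> index the same state.
\<close>

datatype hanoi_state = Trivial | Swap "nat \<Rightarrow> nat"

fun hanoi_step :: "hanoi_state \<Rightarrow> nat \<Rightarrow> hanoi_state" where
  "hanoi_step Trivial x = Trivial"
| "hanoi_step (Swap \<tau>) x = (if \<tau> x = x then Swap \<tau> else Trivial)"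

fun hanoi_out :: "hanoi_state \<Rightarrow> nat \<Rightarrow> nat" where
  "hanoi_out Trivial x = x"
| "hanoi_out (Swap \<tau>) x = \<tau> x"

definition hanoi :: "nat \<Rightarrow> (hanoi_state, nat) automaton" where
  "hanoi m = \<lparr>
     states = insert Trivial {Swap (transpose i j) | i j. i \<in> {1..m} \<and> j \<in> {1..m} \<and> i \<noteq> j},
     alphabet = {1..m},
     step = hanoi_step,
     out = hanoi_out\<rparr>"

lemma hanoi_arrows:
  assumes "i \<noteq> j"
  shows "hanoi_out (Swap (transpose i j)) i = j" "hanoi_step (Swap (transpose i j)) i = Trivial"
    and "hanoi_out (Swap (transpose i j)) j = i" "hanoi_step (Swap (transpose i j)) j = Trivial"
    and "\<lbrakk>x \<noteq> i; x \<noteq> j\<rbrakk> \<Longrightarrow> hanoi_out (Swap (transpose i j)) x = x"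
    and "\<lbrakk>x \<noteq> i; x \<noteq> j\<rbrakk> \<Longrightarrow> hanoi_step (Swap (transpose i j)) x = Swap (transpose i j)"
  using assms by auto

lemma finite_automaton_hanoi: "finite_automaton (hanoi m)"
proof
  have "states (hanoi m) \<subseteq> insert Trivial ((\<lambda>(i, j). Swap (transpose i j)) ` ({1..m} \<times> {1..m}))"
    by (auto simp: hanoi_def)
  moreover have "finite (insert Trivial ((\<lambda>(i, j). Swap (transpose i j)) ` ({1..m} \<times> {1..m})))"
    by (intro finite.insertI finite_imageI finite_cartesian_product finite_atLeastAtMost)
  ultimately show "finite (states (hanoi m))"
    by (rule finite_subset)
next
  show "finite (alphabet (hanoi m))"
    by (simp add: hanoi_def)
next
  fix s x
  assume s: "s \<in> states (hanoi m)" and x: "x \<in> alphabet (hanoi m)"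
  show "step (hanoi m) s x \<in> states (hanoi m)"
    using s by (cases s) (simp_all add: hanoi_def)
  from s consider "s = Trivial"
    | i j where "s = Swap (transpose i j)" "i \<in> {1..m}" "j \<in> {1..m}" "i \<noteq> j"
    unfolding hanoi_def by auto
  then show "out (hanoi m) s x \<in> alphabet (hanoi m)"
  proof cases
    case 1
    then show ?thesis using x by (simp add: hanoi_def)
  next
    case (2 i j)
    then show ?thesis
      using x by (cases "x = i"; cases "x = j") (simp_all add: hanoi_def)
  qed
qed

end

theory Submission
  imports Defs
begin

text \<open>
  A word over the states of the Hanoi automaton is a sequence of moves in the game of the Towers
  of Hanoi, and a word \<open>v\<close> over the alphabet is a configuration of disks: the \<open>i\<close>-th letter is the
  peg of the \<open>i\<close>-th smallest disk. The state \<open>a\<^sub>(\<^sub>i\<^sub>j\<^sub>)\<close> moves the smallest disk on the pegs \<open>i\<close> and \<open>j\<close>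
  from one of them to the other. The section at \<open>v\<close> arises by making trivial the states
  that move one of the disks of \<open>v\<close>; what remains are the moves that act on larger disks.

  A disk that never moves leaves the section unchanged, so its letter can be deleted from \<open>v\<close>
  without changing the section at \<open>v\<close> (\<open>delete_unmoved\<close>). The depth of \<open>w\<close> is therefore at most the
  largest number of disks that \<open>w\<close> can move. A sequence of fewer than \<open>2 ^ p\<close> moves on \<open>j + 2\<close> pegs
  moves at most \<open>(3 * p) ^ j\<close> disks, whatever the initial configuration (\<open>card_movers_le\<close>). With
  \<open>j = m - 2\<close> and \<open>p\<close> about \<open>log\<^sub>2 n\<close> this is the theorem.

  The bound on the number of moved disks follows an argument of Szegedy on the Towers of Hanoi
  with several pegs, by induction on \<open>j\<close> and on \<open>p\<close>. Suppose that fewer than \<open>2 ^ (p + 1)\<close> moves are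
  made, and let \<open>K\<close> consist of the \<open>(3 * p) ^ j + 1\<close> smallest disks that move; call the disks
  beyond them large. By induction on \<open>p\<close>, moving every disk of \<open>K\<close> takes at least \<open>2 ^ p\<close> moves. Cut
  the game at the first moment by which all of \<open>K\<close> has moved. Up to that moment, except for the
  last move, some disk of \<open>K\<close> stands still. After it, fewer than \<open>2 ^ p\<close> moves remain, so again some
  disk of \<open>K\<close> stands still. A disk that stands still makes its peg inaccessible to all
  larger disks (\<open>unmoved_blocks_peg\<close>), so in each of the two phases the large disks play on one peg
  fewer, and together they make fewer than \<open>2 ^ p\<close> moves. By induction on \<open>j\<close> each phase
  moves at most \<open>(3 * p) ^ (j - 1)\<close> large disks. For two pegs only the smallest disk can move.
\<close>

section \<open>Sections and images of concatenations\<close>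

lemma state_image_append:
  "state_image A s (u @ v) = state_image A s u @ state_image A (state_section A s u) v"
  by (induction u arbitrary: s) auto

lemma state_section_append:
  "state_section A s (u @ v) = state_section A (state_section A s u) v"
  by (induction u arbitrary: s) auto

lemma length_state_image [simp]: "length (state_image A s v) = length v"
  by (induction v arbitrary: s) auto

lemma take_state_image: "take i (state_image A s v) = state_image A s (take i v)"
  by (induction v arbitrary: s i) (auto simp: take_Cons split: nat.splits)

lemma length_word_image [simp]: "length (word_image A w v) = length v"
  by (induction w) auto

lemma take_word_image: "take i (word_image A w v) = word_image A w (take i v)"
  by (induction w) (auto simp: take_state_image)

lemma word_image_append:
  "word_image A w (u @ v) = word_image A w u @ word_image A (word_section A w u) v"
  by (induction w) (auto simp: state_image_append)

lemma word_section_append: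
  "word_section A w (u @ v) = word_section A (word_section A w u) v"
  by (induction w) (auto simp: word_image_append state_section_append)

lemma word_image_product: "word_image A (w2 @ w1) v = word_image A w2 (word_image A w1 v)"
  by (induction w2) auto

lemma word_section_product:
  "word_section A (w2 @ w1) v = word_section A w2 (word_image A w1 v) @ word_section A w1 v"
  by (induction w2) (auto simp: word_image_product)

lemma length_word_section [simp]: "length (word_section A w v) = length w"
  by (induction w) auto

lemma word_section_Nil [simp]: "word_section A w [] = w"
proof -
  have "word_image A w [] = []" for w
    using length_word_image[of A w "[]"] by (simp del: length_word_image)
  then show ?thesis by (induction w) auto
qed


section \<open>Moving disks\<close>

text \<open>
  Disks are identified by their positions in \<open>v\<close>. A disk moves in the course of \<open>w\<close> exactly when it
  absorbs one of the states left over by the smaller disks, that is, when its letter changes the section.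
\<close>

definition movers :: "('s, 'x) automaton \<Rightarrow> 's list \<Rightarrow> 'x list \<Rightarrow> nat set" where
  "movers A w v =
     {i. i < length v \<and> word_section A w (take (Suc i) v) \<noteq> word_section A w (take i v)}"

text \<open>
  The number of states of \<open>w\<close> that change under the section at \<open>v\<close>. In the Hanoi automaton these are
  the states that become trivial, so this is the number of moves of the disks in \<open>v\<close>.
\<close>

primrec moves :: "('s, 'x) automaton \<Rightarrow> 's list \<Rightarrow> 'x list \<Rightarrow> nat" where
  "moves A [] v = 0"
| "moves A (s # w) v =
     (if state_section A s (word_image A w v) = s then 0 else 1) + moves A w v"

lemma movers_subset: "movers A w v \<subseteq> {..<length v}"
  by (auto simp: movers_def)

lemma finite_movers [simp]: "finite (movers A w v)"
  using movers_subset by (rule finite_subset) simp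

lemma movers_Nil_word [simp]: "movers A [] v = {}"
  by (simp add: movers_def)

lemma movers_Nil [simp]: "movers A w [] = {}"
  by (simp add: movers_def)

text \<open>
  The laws \<open>movers_append\<close> and \<open>movers_product\<close> cut a game in the two possible directions: into small and large disks, and
  into an earlier and a later phase. The large disks see only the moves that the small disks leave over.
\<close>

lemma movers_append:
  "movers A w (u @ v) = movers A w u \<union> (+) (length u) ` movers A (word_section A w u) v"
proof (rule set_eqI)
  fix i
  show "i \<in> movers A w (u @ v) \<longleftrightarrow>
    i \<in> movers A w u \<union> (+) (length u) ` movers A (word_section A w u) v"
  proof (cases "i < length u")
    case True
    then show ?thesis by (auto simp: movers_def)
  next
    case False
    then obtain k where "i = length u + k"
      using le_Suc_ex not_less by blast
    then show ?thesis
      by (auto simp: movers_def word_section_append Suc_diff_le)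
  qed
qed

lemma card_movers_append:
  "card (movers A w (u @ v)) = card (movers A w u) + card (movers A (word_section A w u) v)"
proof -
  have "movers A w u \<inter> (+) (length u) ` movers A (word_section A w u) v = {}"
    using movers_subset[of A w u] by auto
  then show ?thesis
    by (simp add: movers_append card_Un_disjoint card_image)
qed

lemma card_movers_singleton: "card (movers A w [x]) = (if word_section A w [x] = w then 0 else 1)"
proof -
  have "movers A w [x] = (if word_section A w [x] = w then {} else {0})"
    by (auto simp: movers_def intro: gr0I)
  then show ?thesis by simp
qed

lemma movers_product:
  "movers A (w2 @ w1) v = movers A w1 v \<union> movers A w2 (word_image A w1 v)"
  by (auto simp: movers_def word_section_product take_word_image)

lemma moves_product: "moves A (w2 @ w1) v = moves A w1 v + moves A w2 (word_image A w1 v)"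
  by (induction w2) (auto simp: word_image_product)

lemma moves_le_length: "moves A w v \<le> length w"
  by (induction w) auto

lemma section_eq_if_no_moves: "moves A w v = 0 \<Longrightarrow> word_section A w v = w"
  by (induction w) (auto split: if_splits)

text \<open>A discrete intermediate value argument: each further letter adds at most one mover.\<close>

lemma prefix_with_card_movers:
  assumes "k \<le> card (movers A w v)"
  obtains v1 v2 where "v = v1 @ v2" "card (movers A w v1) = k"
proof -
  have "\<exists>v1 v2. v = v1 @ v2 \<and> card (movers A w v1) = k"
    using assms
  proof (induction v rule: rev_induct)
    case Nil
    then show ?case by simp
  next
    case (snoc x v)
    show ?case
    proof (cases "k \<le> card (movers A w v)")
      case True
      then obtain v1 v2 where "v = v1 @ v2" "card (movers A w v1) = k"
        using snoc.IH by blast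
      then show ?thesis by (intro exI[of _ v1] exI[of _ "v2 @ [x]"]) simp
    next
      case False
      with snoc.prems have "card (movers A w (v @ [x])) = k"
        by (simp add: card_movers_append card_movers_singleton split: if_splits)
      then show ?thesis by (intro exI[of _ "v @ [x]"] exI[of _ "[]"]) simp
    qed
  qed
  then show ?thesis using that by blast
qed

text \<open>
  This reduces the depth of a word to the largest number of disks that it moves: a letter which
  does not change the section can be dropped, and the larger disks still see the same states.
\<close>

lemma delete_unmoved:
  "\<exists>u. set u \<subseteq> set v \<and> word_section A w u = word_section A w v \<and> card (movers A w u) = length u"
proof (induction v arbitrary: w)
  case Nil
  then show ?case by (intro exI[of _ "[]"]) simp
next
  case (Cons x v)
  obtain u where u: "set u \<subseteq> set v"
    "word_section A (word_section A w [x]) u = word_section A (word_section A w [x]) v"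
    "card (movers A (word_section A w [x]) u) = length u"
    using Cons.IH by blast
  have sec: "word_section A w (x # z) = word_section A (word_section A w [x]) z" for z
    using word_section_append[of A w "[x]" z] by simp
  show ?case
  proof (cases "word_section A w [x] = w")
    case True
    then have "word_section A w u = word_section A w (x # v)" "card (movers A w u) = length u"
      using u sec[of v] by simp_all
    with u(1) show ?thesis by (intro exI[of _ u]) auto
  next
    case False
    then have "card (movers A w (x # u)) = length (x # u)"
      using u(3) card_movers_append[of A w "[x]" u] by (simp add: card_movers_singleton)
    moreover have "word_section A w (x # u) = word_section A w (x # v)"
      by (simp only: sec[of u] sec[of v] u(2))
    moreover have "set (x # u) \<subseteq> set (x # v)"
      using u(1) by auto
    ultimately show ?thesis by blast
  qed
qed


section \<open>The moves of the Hanoi automaton\<close>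

text \<open>
  The trivial state is admitted on every set of pegs. Thus making states trivial preserves the
  property, and sections on fewer pegs arise without shortening the word.
\<close>

definition swap_word :: "nat set \<Rightarrow> hanoi_state list \<Rightarrow> bool" where
  "swap_word P w \<longleftrightarrow>
     (\<forall>\<tau>. Swap \<tau> \<in> set w \<longrightarrow> (\<exists>i\<in>P. \<exists>j\<in>P. i \<noteq> j \<and> \<tau> = transpose i j))"

lemma swap_word_simps [simp]:
  "swap_word P []"
  "swap_word P (Trivial # w) \<longleftrightarrow> swap_word P w"
  "swap_word P (Swap \<tau> # w) \<longleftrightarrow>
     (\<exists>i\<in>P. \<exists>j\<in>P. i \<noteq> j \<and> \<tau> = transpose i j) \<and> swap_word P w"
  by (auto simp: swap_word_def)

lemma swap_word_append [simp]: "swap_word P (u @ w) \<longleftrightarrow> swap_word P u \<and> swap_word P w"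
  by (auto simp: swap_word_def)

lemma hanoi_step_out [simp]: "step (hanoi m) = hanoi_step" "out (hanoi m) = hanoi_out"
  by (simp_all add: hanoi_def)

lemma state_section_Trivial [simp]: "state_section (hanoi m) Trivial v = Trivial"
  by (induction v) auto

text \<open>A state is used up by the first disk that it moves.\<close>

lemma hanoi_state_section_cases:
  "state_section (hanoi m) s v = s \<or> state_section (hanoi m) s v = Trivial"
  by (induction v) (cases s; auto)+

text \<open>
  Since each state moves at most one disk, the moves of small and of large disks are counted
  separately. This fails for automata in which a state can change more than once along a path.
\<close>

lemma moves_append:
  "moves (hanoi m) w (u @ v) =
     moves (hanoi m) w u + moves (hanoi m) (word_section (hanoi m) w u) v"
proof (induction w)
  case Nil
  then show ?case by simp
next
  case (Cons s w)
  show ?case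
    using Cons hanoi_state_section_cases[of m s "word_image (hanoi m) w u"]
    by (auto simp: word_image_append state_section_append)
qed

lemma swap_word_section: "swap_word P w \<Longrightarrow> swap_word P (word_section (hanoi m) w v)"
proof (induction w)
  case (Cons s w)
  then have "swap_word P (word_section (hanoi m) w v)" "swap_word P [s]"
    by (cases s; simp)+
  then show ?case
    using hanoi_state_section_cases[of m s "word_image (hanoi m) w v"]
    by (auto simp: swap_word_def)
qed simp

lemma swap_word_image_in:
  assumes "swap_word P w" "i < length v" "v ! i \<in> P"
  shows "word_image (hanoi m) w v ! i \<in> P"
proof -
  have single: "state_image (hanoi m) s v ! i \<in> P"
    if "swap_word P [s]" "i < length v" "v ! i \<in> P" for s v i
    using that
  proof (induction v arbitrary: s i)
    case (Cons x v)
    then show ?case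
      by (cases s; cases i) (auto simp: transpose_def split: if_splits)
  qed simp
  show ?thesis
    using assms
  proof (induction w)
    case (Cons s w)
    then have "swap_word P [s]" "swap_word P w"
      by (cases s; simp)+
    with Cons show ?case by (auto intro!: single)
  qed simp
qed

lemma section_outside:
  assumes "swap_word P w" "x \<notin> P"
  shows "word_section (hanoi m) w [x] = w \<and> word_image (hanoi m) w [x] = [x]"
  using assms(1)
proof (induction w)
  case (Cons s w)
  with assms(2) show ?case
    by (cases s) (auto simp: transpose_def)
qed simp

lemma mover_on_peg:
  assumes "swap_word P w" "i \<in> movers (hanoi m) w v"
  shows "v ! i \<in> P"
proof (rule ccontr)
  assume "v ! i \<notin> P"
  then have "word_section (hanoi m) (word_section (hanoi m) w (take i v)) [v ! i]
    = word_section (hanoi m) w (take i v)"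
    using section_outside swap_word_section assms(1) by blast
  with assms(2) show False
    by (auto simp: movers_def take_Suc_conv_app_nth word_section_append)
qed

text \<open>
  While a disk rests on a peg, every state touching this peg moves that disk or a smaller one. As the
  disk does not move, all such states are absorbed by smaller disks, and none is left in the section.
\<close>

lemma unmoved_blocks_peg:
  assumes "swap_word P w" "d < length v" "d \<notin> movers (hanoi m) w v"
  shows "swap_word (P - {v ! d}) (word_section (hanoi m) w v)"
proof -
  have single: "swap_word (P - {x}) w \<and> word_image (hanoi m) w [x] = [x]"
    if "swap_word P w" "word_section (hanoi m) w [x] = w" for w x
    using that
  proof (induction w)
    case (Cons s w)
    then have *: "word_image (hanoi m) w [x] = [x]" "swap_word (P - {x}) w"
      by (cases s; auto)+
    show ?case
    proof (cases s)
      case Trivial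
      with * show ?thesis by simp
    next
      case (Swap \<tau>)
      with Cons.prems * obtain i j where
        ij: "i \<in> P" "j \<in> P" "i \<noteq> j" "\<tau> = transpose i j" and fix_x: "\<tau> x = x"
        by (auto split: if_splits)
      then have "x \<noteq> i" "x \<noteq> j"
        by auto
      with Swap ij fix_x * show ?thesis by auto
    qed
  qed simp
  have v: "v = take d v @ [v ! d] @ drop (Suc d) v"
    using assms(2) by (simp add: id_take_nth_drop)
  have "word_section (hanoi m) (word_section (hanoi m) w (take d v)) [v ! d]
    = word_section (hanoi m) w (take d v)"
    using assms(2,3) by (simp add: movers_def take_Suc_conv_app_nth word_section_append)
  moreover have "swap_word P (word_section (hanoi m) w (take d v))"
    using assms(1) by (rule swap_word_section)
  ultimately have "swap_word (P - {v ! d}) (word_section (hanoi m) w (take d v @ [v ! d]))"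
    using single by (simp add: word_section_append)
  then show ?thesis
    using swap_word_section word_section_append v by (metis append_assoc)
qed


section \<open>The lower bound for the number of moves\<close>

text \<open>
  With only two pegs every nontrivial state touches the peg of any given disk, so the first
  disk on them absorbs everything.
\<close>

lemma card_movers_two_pegs:
  assumes w: "swap_word P w" and P: "card P = 2"
  shows "card (movers (hanoi m) w v) \<le> 1"
proof (rule ccontr)
  assume "\<not> ?thesis"
  then have many: "2 \<le> card (movers (hanoi m) w v)" by simp
  then have "1 \<le> card (movers (hanoi m) w v)" by simp
  then obtain v1 v2 where v: "v = v1 @ v2" "card (movers (hanoi m) w v1) = 1"
    by (rule prefix_with_card_movers)
  then obtain d where d: "d \<in> movers (hanoi m) w v1"
    by (auto simp: card_1_singleton_iff)
  \<comment> \<open>The image letter stays among the two pegs, which keeps the induction on \<open>w\<close> going.\<close>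
  have single: "swap_word {} (word_section (hanoi m) w [x]) \<and> hd (word_image (hanoi m) w [x]) \<in> P"
    if "swap_word P w" "x \<in> P" for w x
  proof -
    show ?thesis
      using that(1)
    proof (induction w)
      case Nil
      then show ?case using that(2) by simp
    next
      case (Cons s w)
      then have IH: "swap_word {} (word_section (hanoi m) w [x])"
        "hd (word_image (hanoi m) w [x]) \<in> P"
        by (cases s; auto)+
      obtain y where y: "word_image (hanoi m) w [x] = [y]"
        using length_word_image[of "hanoi m" w "[x]"]
        by (cases "word_image (hanoi m) w [x]") auto
      show ?case
      proof (cases s)
        case Trivial
        then show ?thesis using IH y by simp
      next
        case (Swap \<tau>)
        with Cons.prems obtain i j where ij: "i \<in> P" "j \<in> P" "i \<noteq> j" "\<tau> = transpose i j"
          by auto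
        have "P = {i, j}"
          using P ij by (auto simp: card_2_iff)
        then show ?thesis
          using IH y ij Swap by auto
      qed
    qed
  qed
  have "d < length v1"
    using d movers_subset by blast
  then have v1: "v1 = take d v1 @ [v1 ! d] @ drop (Suc d) v1"
    by (simp add: id_take_nth_drop)
  have "swap_word {} (word_section (hanoi m) (word_section (hanoi m) w (take d v1)) [v1 ! d])"
    using single[OF swap_word_section[OF w] mover_on_peg[OF w d]] by blast
  then have "swap_word {} (word_section (hanoi m) w v1)"
    using swap_word_section word_section_append v1 by metis
  then have "movers (hanoi m) (word_section (hanoi m) w v1) v2 = {}"
    using mover_on_peg by (metis empty_iff equals0I)
  with many v show False
    by (simp add: card_movers_append)
qed

text \<open>
  The suffix \<open>u\<close> is the initial phase of the game, up to the first moment by which all of \<open>K\<close>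
  has moved. Before its last move, some disk of \<open>K\<close> has never moved and has blocked its peg \<open>q\<close>. The
  last move has no effect on larger disks: the state making it is absorbed by a disk of \<open>K\<close>
  and becomes trivial in the section.
\<close>

lemma minimal_suffix_moving:
  assumes "swap_word P w" "K \<noteq> {}" "K \<subseteq> movers (hanoi m) w v"
  obtains w2 u q where "w = w2 @ u" "K \<subseteq> movers (hanoi m) u v"
    "q \<in> P" "swap_word (P - {q}) (word_section (hanoi m) u v)"
proof -
  have "\<exists>w2 u q. w = w2 @ u \<and> K \<subseteq> movers (hanoi m) u v \<and> q \<in> P \<and>
      swap_word (P - {q}) (word_section (hanoi m) u v)"
    using assms(1,3)
  proof (induction w)
    case Nil
    then show ?case using assms(2) by simp
  next
    case (Cons s w)
    have w: "swap_word P w"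
      using Cons.prems(1) by (cases s) auto
    show ?case
    proof (cases "K \<subseteq> movers (hanoi m) w v")
      case True
      then obtain w2 u q where "w = w2 @ u" "K \<subseteq> movers (hanoi m) u v"
        "q \<in> P" "swap_word (P - {q}) (word_section (hanoi m) u v)"
        using Cons.IH w by blast
      then show ?thesis
        by (intro exI[of _ "s # w2"] exI[of _ u] exI[of _ q]) simp
    next
      case False
      then obtain d where d: "d \<in> K" "d \<notin> movers (hanoi m) w v" by blast
      have dm: "d \<in> movers (hanoi m) (s # w) v"
        using d Cons.prems by blast
      let ?z = "word_image (hanoi m) w v"
      have dz: "d \<in> movers (hanoi m) [s] ?z"
        using dm d(2) movers_product[of "hanoi m" "[s]" w v] by simp
      \<comment> \<open>If \<open>s\<close> survived all of \<open>v\<close>, it would have survived each prefix and moved no disk.\<close>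
      have "state_section (hanoi m) s ?z = Trivial"
      proof (rule ccontr)
        assume *: "state_section (hanoi m) s ?z \<noteq> Trivial"
        have "state_section (hanoi m) s (take k ?z) = s" for k
        proof (rule ccontr)
          assume "state_section (hanoi m) s (take k ?z) \<noteq> s"
          then have "state_section (hanoi m) s (take k ?z) = Trivial"
            using hanoi_state_section_cases by blast
          then have "state_section (hanoi m) s ?z = Trivial"
            using state_section_append[of "hanoi m" s "take k ?z" "drop k ?z"] by simp
          with * show False by simp
        qed
        with dz show False by (simp add: movers_def)
      qed
      moreover have "d < length v"
        using dm movers_subset by blast
      ultimately have "swap_word (P - {v ! d}) (word_section (hanoi m) (s # w) v)"
        using unmoved_blocks_peg[OF w _ d(2)] by simp
      moreover have "v ! d \<in> P"
        using mover_on_peg[OF Cons.prems(1) dm] .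
      ultimately show ?thesis
        using Cons.prems(2) by (intro exI[of _ "[]"] exI[of _ "s # w"] exI[of _ "v ! d"]) simp
    qed
  qed
  then show ?thesis using that by blast
qed

text \<open>
  The bound satisfies the recursion that the two phases impose: the maximal numbers \<open>B\<^sub>j(p)\<close> of
  moved disks obey \<open>B\<^sub>j(p + 1) \<le> B\<^sub>j(p) + 1 + 2 * B\<^sub>j\<^sub>-\<^sub>1(p)\<close>, where the factor 2 counts the phases.
  Counting the moves of the disks in \<open>v\<close> instead of the length of \<open>w\<close> is essential, as it charges the small
  and the large disks for different moves.
\<close>

lemma card_movers_le:
  assumes "swap_word P w" "card P = j + 2" "moves (hanoi m) w v < 2 ^ p"
  shows "card (movers (hanoi m) w v) \<le> (3 * p) ^ j"
  using assms
proof (induction j arbitrary: P w v p)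
  case 0
  then show ?case using card_movers_two_pegs by simp
next
  case (Suc j)
  note fewer_pegs = Suc.IH
  from Suc.prems show ?case
  proof (induction p arbitrary: w v)
    case 0
    then have "moves (hanoi m) w v = 0" by simp
    moreover have "moves (hanoi m) w v =
        moves (hanoi m) w (take i v) + moves (hanoi m) (word_section (hanoi m) w (take i v)) (drop i v)" for i
      using moves_append[of m w "take i v" "drop i v"] by simp
    ultimately have "word_section (hanoi m) w (take i v) = w" for i
      by (intro section_eq_if_no_moves) (metis add_eq_0_iff_both_eq_0)
    then have "movers (hanoi m) w v = {}"
      by (simp add: movers_def)
    then show ?case by simp
  next
    case (Suc p)
    let ?A = "hanoi m" and ?B = "(3 * p) ^ Suc j"
    have recursion: "?B + 1 + 2 * (3 * p) ^ j \<le> (3 * Suc p) ^ Suc j"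
    proof -
      have "(3 * p) ^ j \<le> (3 * Suc p) ^ j" "1 \<le> (3 * Suc p) ^ j"
        by (intro power_mono; simp) simp
      moreover from this(1) have "3 * p * (3 * p) ^ j \<le> 3 * p * (3 * Suc p) ^ j"
        by (rule mult_le_mono2)
      ultimately have "3 * p * (3 * p) ^ j + 1 + 2 * (3 * p) ^ j
          \<le> 3 * p * (3 * Suc p) ^ j + 3 * (3 * Suc p) ^ j"
        by linarith
      then show ?thesis by (simp add: algebra_simps)
    qed
    show ?case
    proof (cases "card (movers ?A w v) \<le> ?B")
      case True
      then show ?thesis using recursion by linarith
    next
      case False
      then have "?B + 1 \<le> card (movers ?A w v)" by simp
      then obtain v1 v2 where v: "v = v1 @ v2" and card: "card (movers ?A w v1) = ?B + 1"
        by (rule prefix_with_card_movers)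
      let ?K = "movers ?A w v1"
      \<comment> \<open>The contrapositive of the induction hypothesis on \<open>p\<close>.\<close>
      have half: "2 ^ p \<le> moves ?A w' v'"
        if "swap_word P w'" "?B < card (movers ?A w' v')" for w' v'
        using Suc.IH[OF that(1)] Suc.prems(2) that(2) by (meson not_le)
      have "?K \<noteq> {}" using card by auto
      \<comment> \<open>The first phase \<open>u\<close>, in which \<open>q\<close> is blocked, is followed by \<open>w2\<close>.\<close>
      then obtain w2 u q where w: "w = w2 @ u" and K: "?K \<subseteq> movers ?A u v1"
        and q: "q \<in> P" and u: "swap_word (P - {q}) (word_section ?A u v1)"
        using minimal_suffix_moving[OF Suc.prems(1)] by blast
      have sw: "swap_word P u" "swap_word P w2"
        using Suc.prems(1) w by auto
      let ?v1 = "word_image ?A u v1"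
      have small: "moves ?A w v1 = moves ?A u v1 + moves ?A w2 ?v1"
        by (simp add: w moves_product)
      have total: "moves ?A w v = moves ?A w v1 + moves ?A (word_section ?A w v1) v2"
        by (simp add: v moves_append)
      have "?B < card (movers ?A u v1)"
        using card_mono[OF finite_movers K] card by simp
      then have u_half: "2 ^ p \<le> moves ?A u v1"
        by (rule half[OF sw(1)])
      then have "moves ?A w2 ?v1 < 2 ^ p"
        using small total Suc.prems(3) by simp
      then have "card (movers ?A w2 ?v1) < card ?K"
        using Suc.IH[OF sw(2) Suc.prems(2)] card by (simp add: less_Suc_eq_le)
      \<comment> \<open>The second phase is too short to move all of \<open>?K\<close>, so \<open>d\<close> blocks \<open>?q\<close> throughout it.\<close>
      then obtain d where d: "d \<in> ?K" "d \<notin> movers ?A w2 ?v1"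
        by (meson card_mono finite_movers not_less subsetI)
      have d_len: "d < length v1" 
        using d(1) movers_subset by blast
      let ?q = "?v1 ! d"
      have q': "?q \<in> P"
        using swap_word_image_in[OF sw(1) d_len] mover_on_peg[OF Suc.prems(1) d(1)] by blast
      have w2: "swap_word (P - {?q}) (word_section ?A w2 ?v1)"
        using unmoved_blocks_peg[OF sw(2) _ d(2)] d_len by simp
      have P: "card (P - {x}) = j + 2" if "x \<in> P" for x
        using Suc.prems(2) that by simp
      have sec: "word_section ?A w v1 = word_section ?A w2 ?v1 @ word_section ?A u v1"
        by (simp add: w word_section_product)
      \<comment> \<open>The small disks already use \<open>2 ^ p\<close> of the fewer than \<open>2 ^ (p + 1)\<close> moves.\<close>
      have large: "moves ?A (word_section ?A u v1) v2
          + moves ?A (word_section ?A w2 ?v1) (word_image ?A (word_section ?A u v1) v2) < 2 ^ p"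
        using small total u_half Suc.prems(3) by (simp add: sec moves_product)
      have "card (movers ?A (word_section ?A w v1) v2)
          \<le> card (movers ?A (word_section ?A u v1) v2)
            + card (movers ?A (word_section ?A w2 ?v1) (word_image ?A (word_section ?A u v1) v2))"
        unfolding sec movers_product by (rule card_Un_le)
      also have "\<dots> \<le> (3 * p) ^ j + (3 * p) ^ j"
        using large by (intro add_mono fewer_pegs[OF u P[OF q]] fewer_pegs[OF w2 P[OF q']]) auto
      finally show ?thesis
        using recursion card by (simp add: v card_movers_append)
    qed
  qed
qed


section \<open>The depth of the Hanoi automaton\<close>

lemma word_depth_hanoi_le:
  assumes "w \<in> lists (states (hanoi m))" "length w < 2 ^ p" "m \<ge> 2"
  shows "word_depth (hanoi m) w \<le> (3 * p) ^ (m - 2)"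
proof -
  have swap: "swap_word {1..m} w"
    using assms(1) by (fastforce simp: swap_word_def hanoi_def lists_eq_set)
  have "\<exists>u \<in> lists (alphabet (hanoi m)). length u \<le> (3 * p) ^ (m - 2) \<and>
      word_section (hanoi m) w v = word_section (hanoi m) w u"
    if v: "v \<in> lists (alphabet (hanoi m))" for v
  proof -
    obtain u where u: "set u \<subseteq> set v" "word_section (hanoi m) w u = word_section (hanoi m) w v"
      "card (movers (hanoi m) w u) = length u"
      using delete_unmoved[where v = v and A = "hanoi m" and w = w] by blast
    have "card (movers (hanoi m) w u) \<le> (3 * p) ^ (m - 2)"
      using assms(2,3) moves_le_length[of "hanoi m" w u]
      by (intro card_movers_le[OF swap]) auto
    then show ?thesis
      using u v by (intro bexI[of _ u]) (auto simp: lists_eq_set)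
  qed
  then show ?thesis
    unfolding word_depth_def by (intro Least_le) blast
qed

lemma depth_function_hanoi_le:
  assumes "n < 2 ^ p" "m \<ge> 2"
  shows "depth_function (hanoi m) n \<le> (3 * p) ^ (m - 2)"
proof -
  have "{w \<in> lists (states (hanoi m)). length w \<le> n} \<noteq> {}"
    by (auto intro: exI[of _ "[]"])
  moreover have "word_depth (hanoi m) w \<le> (3 * p) ^ (m - 2)"
    if "w \<in> {w \<in> lists (states (hanoi m)). length w \<le> n}" for w
    using that assms by (intro word_depth_hanoi_le) auto
  ultimately show ?thesis
    unfolding depth_function_def
    using finite_automaton.finite_words[OF finite_automaton_hanoi, of m n]
    by (subst Max_le_iff) (blast intro: finite_imageI)+
qed

text \<open>
  For \<open>2 ^ p \<le> n < 2 ^ (p + 1)\<close> and \<open>n \<ge> 3\<close> one has \<open>p \<le> 2 * ln n\<close> and \<open>1 \<le> ln n\<close>, hence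
  \<open>3 * (p + 1) \<le> 9 * ln n\<close>; this explains the constant \<open>9 ^ (m - 2)\<close>.
\<close>

theorem theorem1:
  fixes m :: nat
  assumes "m \<ge> 3"
  shows "(\<lambda>n. real (depth_function (hanoi m) n)) \<in> O(\<lambda>n. ln (real n) ^ (m - 2))"
proof (rule bigoI)
  show "\<forall>\<^sub>F n in sequentially.
      norm (real (depth_function (hanoi m) n)) \<le> 9 ^ (m - 2) * norm (ln (real n) ^ (m - 2))"
    using eventually_ge_at_top[of 3]
  proof eventually_elim
    case (elim n)
    obtain p where p: "2 ^ p \<le> n" "n < 2 ^ (p + 1)"
      using ex_power_ivl1[of 2 n] elim by auto
    have "exp 1 \<le> real n"
      using exp_le elim by linarith
    then have "1 \<le> ln (real n)"
      using elim by (subst ln_ge_iff) auto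
    moreover have "real p * ln 2 \<le> ln (real n)"
      using p(1) elim by (simp flip: ln_realpow add: numeral_power_le_of_nat_cancel_iff)
    moreover have "real p * (1 / 2) \<le> real p * ln 2"
      using ln_le_minus_one[of "1 / 2"] by (intro mult_left_mono) (auto simp: ln_div)
    ultimately have "real (3 * (p + 1)) \<le> 9 * ln (real n)" "0 \<le> ln (real n)"
      by auto
    then have "real ((3 * (p + 1)) ^ (m - 2)) \<le> 9 ^ (m - 2) * ln (real n) ^ (m - 2)"
      by (metis of_nat_power power_mono of_nat_0_le_iff power_mult_distrib)
    moreover have "depth_function (hanoi m) n \<le> (3 * (p + 1)) ^ (m - 2)"
      using p(2) assms by (intro depth_function_hanoi_le) auto
    ultimately show ?case
      using \<open>0 \<le> ln (real n)\<close> by (simp add: order_trans[OF of_nat_mono])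
  qed
qed

end
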